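(* Let $\{a_n\}_{n\ge1}$ be self-adjoint variables in $(\mathcal{A},\varphi)$, and suppose there exist $\alpha\in\mathbb{R}$ and a sequence $\{K_n\}_{n\ge1}$ of positive numbers such that the following two conditions hold. (C1) As $n\to\infty$, $(a_n-\alpha)/K_n\stackrel{*}{\to}l$, where $l$ is a self-adjoint variable in some non-commutative probability space $(\mathcal{B},\bar\varphi)$. (C2) For any small $\epsilon,\epsilon'>0$, there exists a large $M\in\mathbb{N}$ such that for any $n>M$ and $m\in\mathbb{N}$, $$\Big|\varphi\Big[\Big(\frac{a_{n'}-a_n}{K_n}\Big)^m\Big]\Big|<\epsilon\quad\text{whenever } |n'-n|<n\epsilon'.$$ Let $\{w_n\}_{n\ge1}$ be an increasing sequence of positive integers with $w_n\to\infty$. Let $\{N_n\}$ be non-negative integer-valued random variables such that $N_n/w_n\to1$ in probability, and let $\{(K_{N_n}/K_{w_n})^m\}_{n\ge1}$ be uniformly integrable for all $m\in\mathbb{N}$. Then $$\frac{a_{N_n}-\alpha}{K_{w_n}}\stackrel{*}{\to}l\quad\text{as } n\to\infty.$$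
   Context: $(\mathcal{A},\varphi)$ is a non-commutative probability space (NCP), that is, a unital algebra $\mathcal{A}$ with unit $1_{\mathcal{A}}$ (carrying an involution $*$, so that self-adjoint means $a=a^*$) and a linear functional $\varphi:\mathcal{A}\to\mathbb{C}$ with $\varphi(1_{\mathcal{A}})=1$; moreover $\varphi$ is tracial: $\varphi(ab)=\varphi(ba)$ for all $a,b\in\mathcal{A}$. Scalars such as $\alpha$ are identified with $\alpha 1_{\mathcal{A}}$. All the random variables $N_n$ have finite moments of all orders and are independent of $\mathcal{A}$; by convention $a_0=0$. The randomly indexed variable $a_{N_n}=\sum_{i\ge0}a_i\mathbb{I}_{\{N_n=i\}}$ lives in a larger non-commutative probability space with state $\tilde\varphi=\mathbb{E}\varphi$, so that for a polynomial $P$, $\tilde\varphi(P(a_{N_n}))=\sum_{i\ge0}\mathbb{P}\{N_n=i\}\varphi(P(a_i))$. For self-adjoint variables, $x_n\stackrel{*}{\to}x$ means that every moment of $x_n$ (computed in its state) converges to the corresponding moment of $x$.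
   Formalization: The functional φ is additionally assumed positive (φ(a*a) ≥ 0), without which the claim is false; K_0, needed when N_n = 0, is an arbitrary positive number; and m ≥ 1 in (C2), since m = 0 would be contradictory. *)

theory Defs
  imports "HOL-Probability.Probability" "HOL-Library.Function_Algebras"
begin

(* A unital complex algebra with an involution.  The scalar multiplication is a locale
   parameter because the library has no type class of complex algebras. *)
locale complex_star_algebra = vector_space scale
  for scale :: "complex \<Rightarrow> 'a::ring_1 \<Rightarrow> 'a" +
  fixes star :: "'a \<Rightarrow> 'a"
  assumes scale_mult_left: "scale c x * y = scale c (x * y)"
    and scale_mult_right: "x * scale c y = scale c (x * y)"
    and star_star: "star (star x) = x"
    and star_add: "star (x + y) = star x + star y"
    and star_scale: "star (scale c x) = scale (cnj c) (star x)"
    and star_mult: "star (x * y) = star y * star x"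

(* Neither positivity nor traciality of the functional is part of this notion. *)
locale noncommutative_probability_space = complex_star_algebra scale star
  for scale :: "complex \<Rightarrow> 'a::ring_1 \<Rightarrow> 'a" and star :: "'a \<Rightarrow> 'a" +
  fixes \<phi> :: "'a \<Rightarrow> complex"
  assumes linear_functional: "Vector_Spaces.linear scale (*) \<phi>"
    and unital: "\<phi> 1 = 1"

definition tracial :: "('a::times \<Rightarrow> complex) \<Rightarrow> bool" where
  "tracial \<phi> \<longleftrightarrow> (\<forall>a b. \<phi> (a * b) = \<phi> (b * a))"

definition positive_functional :: "('a::times \<Rightarrow> 'a) \<Rightarrow> ('a \<Rightarrow> complex) \<Rightarrow> bool" where
  "positive_functional star \<phi> \<longleftrightarrow> (\<forall>a. \<phi> (star a * a) \<in> \<real>\<^sub>\<ge>\<^sub>0)"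

definition self_adjoint :: "('a \<Rightarrow> 'a) \<Rightarrow> 'a \<Rightarrow> bool" where
  "self_adjoint star a \<longleftrightarrow> star a = a"

(* Convergence of all moments of x n, computed in the functional \<Phi> n, to those of l, computed
   in \<psi>.  For self-adjoint variables the *-moments are exactly the moments. *)
definition moments_converge ::
  "(nat \<Rightarrow> 'a::monoid_mult \<Rightarrow> complex) \<Rightarrow> (nat \<Rightarrow> 'a) \<Rightarrow> ('b::monoid_mult \<Rightarrow> complex) \<Rightarrow> 'b \<Rightarrow> bool"
  where
  "moments_converge \<Phi> x \<psi> l \<longleftrightarrow> (\<forall>m::nat. (\<lambda>n. \<Phi> n (x n ^ m)) \<longlonglongrightarrow> \<psi> (l ^ m))"

(* The functional E \<phi> on random elements of the algebra, i.e. on functions on the sample space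
   with values in the algebra.  These carry the pointwise operations of Function_Algebras, so
   that algebra elements (constant functions) are independent of scalar random variables, and
   the sum over i of a_i times the indicator of N = i is the function mapping o to a (N o). *)
definition expectation_functional ::
  "'o measure \<Rightarrow> ('a \<Rightarrow> complex) \<Rightarrow> ('o \<Rightarrow> 'a) \<Rightarrow> complex" where
  "expectation_functional P \<phi> X = (\<integral>\<omega>. \<phi> (X \<omega>) \<partial>P)"

definition converges_in_probability ::
  "'o measure \<Rightarrow> (nat \<Rightarrow> 'o \<Rightarrow> real) \<Rightarrow> real \<Rightarrow> bool" where
  "converges_in_probability P X c \<longleftrightarrow>
     (\<forall>e>0. (\<lambda>n. measure P {\<omega> \<in> space P. \<bar>X n \<omega> - c\<bar> > e}) \<longlonglongrightarrow> 0)"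

definition uniformly_integrable ::
  "'o measure \<Rightarrow> 'i set \<Rightarrow> ('i \<Rightarrow> 'o \<Rightarrow> real) \<Rightarrow> bool" where
  "uniformly_integrable P I X \<longleftrightarrow>
     (\<forall>i\<in>I. integrable P (X i)) \<and>
     (\<forall>e>0. \<exists>c. \<forall>i\<in>I. (LINT \<omega>:{\<omega> \<in> space P. \<bar>X i \<omega>\<bar> > c}|P. \<bar>X i \<omega>\<bar>) < e)"

end

theory Submission
  imports Defs
begin

text \<open>
  With s = (a_N - \<alpha>) / K_w and x = (a_w - \<alpha>) / K_w, telescope s^m - x^m into the terms
  s^k (s - x) x^j. Traciality and two applications of Cauchy-Schwarz bound the functional of such
  a term by the second moment of s - x and the moments of s and x of orders 4k and 4j, so no mixed
  moment and no noncommutative Hoelder inequality is needed. Condition (C2) makes the second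
  moment of s - x small when N is close to w, while (C1) bounds the moments of s by powers of
  K_N / K_w, which uniform integrability controls in the mean and on the event that N is far from w.
\<close>

section \<open>Algebra of powers\<close>

lemma fun_power_apply: "(f ^ m) x = (f x :: 'b::monoid_mult) ^ m"
  by (induction m) (simp_all add: one_fun_def times_fun_def)

text \<open>The sum telescopes. Since \<open>s\<close> and \<open>x\<close> need not commute, each
  term keeps all powers of \<open>s\<close> on the left and all powers of \<open>x\<close> on the
  right; the induction splits s^(m+1) - x^(m+1) as (s^m - x^m) x + s^m (s - x).\<close>

lemma power_diff_noncommutative:
  fixes s x :: "'a::ring_1"
  shows "s ^ m - x ^ m = (\<Sum>k<m. s ^ k * (s - x) * x ^ (m - 1 - k))"
proof (induction m)
  case (Suc m)
  have "(\<Sum>k<Suc m. s ^ k * (s - x) * x ^ (Suc m - 1 - k))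
      = (\<Sum>k<m. s ^ k * (s - x) * x ^ (m - 1 - k) * x) + s ^ m * (s - x)"
  proof -
    have "s ^ k * (s - x) * x ^ (m - k) = s ^ k * (s - x) * x ^ (m - 1 - k) * x" if "k < m" for k
    proof -
      have "m - k = Suc (m - 1 - k)"
        using that by simp
      then show ?thesis
        by (simp add: power_Suc2 mult.assoc del: power_Suc)
    qed
    then show ?thesis by simp
  qed
  also have "\<dots> = (s ^ m - x ^ m) * x + s ^ m * (s - x)"
    by (simp add: Suc.IH sum_distrib_right)
  also have "\<dots> = s ^ Suc m - x ^ Suc m"
    by (simp add: algebra_simps power_Suc2 del: power_Suc)
  finally show ?case by simp
qed simp

section \<open>Inequalities for a positive tracial functional\<close>

context noncommutative_probability_space
begin

lemma functional_add: "\<phi> (x + y) = \<phi> x + \<phi> y"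
  and functional_scale: "\<phi> (scale c x) = c * \<phi> x"
  and functional_diff: "\<phi> (x - y) = \<phi> x - \<phi> y"
  and functional_sum: "\<phi> (sum f I) = (\<Sum>i\<in>I. \<phi> (f i))"
proof -
  interpret Vector_Spaces.linear scale "(*)" \<phi>
    by (rule linear_functional)
  show "\<phi> (x + y) = \<phi> x + \<phi> y" by (rule add)
  show "\<phi> (scale c x) = c * \<phi> x" by (rule scale)
  show "\<phi> (x - y) = \<phi> x - \<phi> y" by (rule diff)
  show "\<phi> (sum f I) = (\<Sum>i\<in>I. \<phi> (f i))" by (rule sum)
qed

lemma scale_power: "scale c x ^ m = scale (c ^ m) (x ^ m)"
  by (induction m) (simp_all add: scale_mult_left scale_mult_right)

lemma star_zero: "star 0 = 0"
  using star_add[of 0 0] by simp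

lemma star_one: "star 1 = 1"
  using star_mult[of "star 1" 1] by (simp add: star_star)

lemma star_diff: "star (x - y) = star x - star y"
  using star_add[of "x - y" y] by simp

lemma self_adjoint_diff:
  "self_adjoint star x \<Longrightarrow> self_adjoint star y \<Longrightarrow> self_adjoint star (x - y)"
  by (simp add: self_adjoint_def star_diff)

lemma self_adjoint_scale_of_real:
  "self_adjoint star x \<Longrightarrow> self_adjoint star (scale (complex_of_real r) x)"
  by (simp add: self_adjoint_def star_scale)

lemma self_adjoint_power: "self_adjoint star x \<Longrightarrow> self_adjoint star (x ^ k)"
  unfolding self_adjoint_def
  by (induction k) (simp_all add: star_one star_mult power_commutes)

text \<open>Positivity is applied to \<open>u + scale c v\<close>, where \<open>c\<close> has
  modulus \<eta> and a phase that turns the cross terms into -2 \<eta> |\<phi>(u* v)|; then one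
  divides by \<eta>. The weighted sum avoids square roots and leaves \<eta> free to be matched with
  the size of \<open>u\<close>. Positivity enters the whole argument through this lemma
  alone.\<close>

lemma positive_functional_Cauchy_Schwarz:
  assumes pos: "positive_functional star \<phi>" and "\<eta> > 0"
  shows "2 * cmod (\<phi> (star u * v)) \<le> Re (\<phi> (star u * u)) / \<eta> + \<eta> * Re (\<phi> (star v * v))"
proof -
  have nonneg: "Re (\<phi> (star z * z)) \<ge> 0" and real: "Im (\<phi> (star z * z)) = 0" for z
    using pos by (auto simp: positive_functional_def complex_nonneg_Reals_iff)
  have expand: "\<phi> (star (u + scale c v) * (u + scale c v)) = \<phi> (star u * u) + c * \<phi> (star u * v)
      + cnj c * \<phi> (star v * u) + cnj c * c * \<phi> (star v * v)" for c
    by (simp add: star_add star_scale algebra_simps scale_mult_left scale_mult_right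
        functional_add functional_scale)
  \<comment> \<open>Polarization: \<phi>(z* z) is real for z = u + v and z = u + iv. This forces
    Hermitian symmetry of the cross terms, which is not an axiom for \<phi>.\<close>
  have "Im (\<phi> (star u * v)) + Im (\<phi> (star v * u)) = 0"
    using real[of "u + scale 1 v"] unfolding expand by (simp add: real)
  moreover have "Re (\<phi> (star u * v)) - Re (\<phi> (star v * u)) = 0"
    using real[of "u + scale \<i> v"] unfolding expand by (simp add: real)
  ultimately have hermitian: "\<phi> (star v * u) = cnj (\<phi> (star u * v))"
    by (simp add: complex_eq_iff)
  define p where "p = \<phi> (star u * v)"
  \<comment> \<open>\<open>d\<close> rotates \<open>p\<close> onto the negative real axis. The case
    p = 0 is separate because \<open>sgn 0 = 0\<close> is not unimodular.\<close>
  obtain d where d: "cmod d = 1" "d * p = - complex_of_real (cmod p)"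
  proof (cases "p = 0")
    case False
    have "cnj (sgn p) * p = cnj (sgn p) * (complex_of_real (cmod p) * sgn p)"
      by (simp add: sgn_eq)
    also have "\<dots> = complex_of_real (cmod p) * complex_of_real ((cmod (sgn p))\<^sup>2)"
      unfolding complex_norm_square by simp
    finally have "- cnj (sgn p) * p = - complex_of_real (cmod p)"
      using False by (simp add: norm_sgn)
    with False show ?thesis
      by (intro that[of "- cnj (sgn p)"]) (auto simp: norm_sgn)
  qed (use that[of 1] in auto)
  define c where "c = complex_of_real \<eta> * d"
  have "c * p = - complex_of_real (\<eta> * cmod p)"
    using d by (simp add: c_def mult.assoc)
  moreover have "cnj c * cnj p = cnj (c * p)" by simp
  moreover have "cnj c * c = complex_of_real (\<eta>\<^sup>2)"
    using complex_norm_square[of c] d(1) by (simp add: c_def norm_mult mult.commute)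
  ultimately have "0 \<le> Re (\<phi> (star u * u)) - 2 * \<eta> * cmod p + \<eta>\<^sup>2 * Re (\<phi> (star v * v))"
    using nonneg[of "u + scale c v"] unfolding expand hermitian p_def[symmetric] by simp
  then show ?thesis
    using \<open>\<eta> > 0\<close> by (simp add: p_def field_simps power2_eq_square)
qed

text \<open>Each telescoping term is treated by Cauchy-Schwarz with the same \<eta> that measures s
  - x: the second moment divided by \<eta> is at most \<eta>, and the other factor carries the
  weight \<eta>. The bound is thus linear in \<eta> and contains only pure moments of
  \<open>s\<close> and \<open>x\<close>.\<close>

lemma functional_power_diff_le:
  assumes pos: "positive_functional star \<phi>" and tr: "tracial \<phi>"
    and s: "self_adjoint star s" and x: "self_adjoint star x"
    and "\<eta> > 0" and small: "cmod (\<phi> ((s - x) ^ 2)) \<le> \<eta>\<^sup>2"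
  shows "cmod (\<phi> (s ^ m) - \<phi> (x ^ m))
    \<le> \<eta> * (\<Sum>k<m. 1 + cmod (\<phi> (s ^ (4 * k))) + cmod (\<phi> (x ^ (4 * (m - 1 - k)))))"
proof -
  have term_le: "cmod (\<phi> (s ^ k * (s - x) * x ^ j))
      \<le> \<eta> * (1 + cmod (\<phi> (s ^ (4 * k))) + cmod (\<phi> (x ^ (4 * j))))" for k j
  proof -
    have y: "star (s - x) = s - x" and sp: "star (s ^ i) = s ^ i" and xp: "star (x ^ i) = x ^ i" for i
      using self_adjoint_diff[OF s x] self_adjoint_power[OF s] self_adjoint_power[OF x]
      by (auto simp: self_adjoint_def)
    have tr': "\<phi> (p * q) = \<phi> (q * p)" for p q
      using tr by (auto simp: tracial_def)
    \<comment> \<open>The trace moves s^k to the far right, so that s - x stands alone in front and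
      can play the role of \<open>u\<close>.\<close>
    define v where "v = x ^ j * s ^ k"
    have "\<phi> (s ^ k * (s - x) * x ^ j) = \<phi> (star (s - x) * v)"
      unfolding v_def y using tr'[of "s ^ k" "(s - x) * x ^ j"] by (simp add: mult.assoc)
    then have 1: "2 * cmod (\<phi> (s ^ k * (s - x) * x ^ j))
        \<le> Re (\<phi> ((s - x) ^ 2)) / \<eta> + \<eta> * Re (\<phi> (star v * v))"
      using positive_functional_Cauchy_Schwarz[OF pos \<open>\<eta> > 0\<close>, of "s - x" v]
      by (simp add: y power2_eq_square)
    have "Re (\<phi> ((s - x) ^ 2)) \<le> \<eta>\<^sup>2"
      using complex_Re_le_cmod small by (rule order_trans)
    then have 2: "Re (\<phi> ((s - x) ^ 2)) / \<eta> \<le> \<eta>"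
      using \<open>\<eta> > 0\<close> by (simp add: field_simps power2_eq_square)
    \<comment> \<open>A second cyclic shift turns s^k x^(2j) s^k into x^(2j) s^(2k). Cauchy-Schwarz
      with weight 1 then separates the two variables and doubles the exponents to 4j and 4k.\<close>
    have "\<phi> (star v * v) = \<phi> (s ^ k * (x ^ j * x ^ j * s ^ k))"
      by (simp add: v_def star_mult sp xp mult.assoc)
    also have "\<dots> = \<phi> (star (x ^ (2 * j)) * s ^ (2 * k))"
      using tr'[of "s ^ k" "x ^ j * x ^ j * s ^ k"]
      unfolding xp by (simp add: mult_2 power_add mult.assoc)
    finally have "Re (\<phi> (star v * v)) \<le> cmod (\<phi> (star (x ^ (2 * j)) * s ^ (2 * k)))"
      using complex_Re_le_cmod by simp
    moreover have "2 * cmod (\<phi> (star (x ^ (2 * j)) * s ^ (2 * k)))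
        \<le> Re (\<phi> (x ^ (4 * j))) + Re (\<phi> (s ^ (4 * k)))"
      using positive_functional_Cauchy_Schwarz[OF pos zero_less_one, of "x ^ (2 * j)" "s ^ (2 * k)"]
      by (simp add: xp sp flip: power_add)
    moreover have "Re (\<phi> (x ^ (4 * j))) \<le> cmod (\<phi> (x ^ (4 * j)))"
      "Re (\<phi> (s ^ (4 * k))) \<le> cmod (\<phi> (s ^ (4 * k)))"
      by (rule complex_Re_le_cmod)+
    ultimately have "Re (\<phi> (star v * v)) \<le> cmod (\<phi> (s ^ (4 * k))) + cmod (\<phi> (x ^ (4 * j)))"
      using norm_ge_zero[of "\<phi> (x ^ (4 * j))"] norm_ge_zero[of "\<phi> (s ^ (4 * k))"] by linarith
    then have 3: "\<eta> * Re (\<phi> (star v * v)) \<le> \<eta> * (cmod (\<phi> (s ^ (4 * k))) + cmod (\<phi> (x ^ (4 * j))))"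
      using \<open>\<eta> > 0\<close> by simp
    have "0 \<le> \<eta> * (cmod (\<phi> (s ^ (4 * k))) + cmod (\<phi> (x ^ (4 * j))))"
      using \<open>\<eta> > 0\<close> by simp
    moreover have "\<eta> * (1 + cmod (\<phi> (s ^ (4 * k))) + cmod (\<phi> (x ^ (4 * j))))
        = \<eta> + \<eta> * (cmod (\<phi> (s ^ (4 * k))) + cmod (\<phi> (x ^ (4 * j))))"
      by (simp add: algebra_simps)
    ultimately show ?thesis using 1 2 3 \<open>\<eta> > 0\<close> by linarith
  qed
  have "\<phi> (s ^ m) - \<phi> (x ^ m) = (\<Sum>k<m. \<phi> (s ^ k * (s - x) * x ^ (m - 1 - k)))"
    by (simp add: power_diff_noncommutative functional_sum flip: functional_diff)
  also have "cmod \<dots> \<le> (\<Sum>k<m. \<eta> * (1 + cmod (\<phi> (s ^ (4 * k))) + cmod (\<phi> (x ^ (4 * (m - 1 - k))))))"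
    by (intro sum_norm_le term_le)
  finally show ?thesis by (simp add: sum_distrib_left)
qed

end

section \<open>Uniform integrability over events\<close>

text \<open>Cut at the level \<open>c\<close> of the definition: the part above it has integral
  below \<open>e\<close>, and the rest is at most c on \<open>A\<close>. The level serves all
  indices and all events at once, so it can be fixed before the probability of \<open>A\<close> is
  made small.\<close>

lemma (in prob_space) uniformly_integrable_on_sets:
  assumes ui: "uniformly_integrable M I X" and "e > 0"
  obtains c where "c \<ge> 0"
    "\<And>i A. i \<in> I \<Longrightarrow> A \<in> sets M \<Longrightarrow> (\<integral>\<omega>. \<bar>X i \<omega>\<bar> * indicator A \<omega> \<partial>M) \<le> e + c * prob A"
proof -
  obtain c where c: "\<And>i. i \<in> I \<Longrightarrow> (LINT \<omega>:{\<omega> \<in> space M. \<bar>X i \<omega>\<bar> > c}|M. \<bar>X i \<omega>\<bar>) < e"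
    using assms unfolding uniformly_integrable_def by meson
  \<comment> \<open>The absolute value is taken because the level in the definition may be
    negative.\<close>
  have "(\<integral>\<omega>. \<bar>X i \<omega>\<bar> * indicator A \<omega> \<partial>M) \<le> e + \<bar>c\<bar> * prob A" if "i \<in> I" and A: "A \<in> sets M" for i A
  proof -
    have [simp]: "integrable M (X i)"
      using ui \<open>i \<in> I\<close> by (auto simp: uniformly_integrable_def)
    then have [measurable]: "X i \<in> borel_measurable M" by (rule borel_measurable_integrable)
    note A[measurable]
    define T where "T = {\<omega> \<in> space M. \<bar>X i \<omega>\<bar> > c}"
    have [measurable]: "T \<in> sets M" unfolding T_def by measurable
    have intT: "integrable M (\<lambda>\<omega>. \<bar>X i \<omega>\<bar> * indicator T \<omega>)"
      by (rule integrable_real_mult_indicator) auto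
    have "(\<integral>\<omega>. \<bar>X i \<omega>\<bar> * indicator A \<omega> \<partial>M) \<le> (\<integral>\<omega>. \<bar>X i \<omega>\<bar> * indicator T \<omega> + \<bar>c\<bar> * indicator A \<omega> \<partial>M)"
    proof (rule integral_mono)
      show "integrable M (\<lambda>\<omega>. \<bar>X i \<omega>\<bar> * indicator A \<omega>)"
        by (rule integrable_real_mult_indicator) auto
      show "integrable M (\<lambda>\<omega>. \<bar>X i \<omega>\<bar> * indicator T \<omega> + \<bar>c\<bar> * indicator A \<omega>)"
        using intT by (auto intro!: Bochner_Integration.integrable_add simp: emeasure_eq_measure)
      show "\<bar>X i \<omega>\<bar> * indicator A \<omega> \<le> \<bar>X i \<omega>\<bar> * indicator T \<omega> + \<bar>c\<bar> * indicator A \<omega>"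
        if "\<omega> \<in> space M" for \<omega>
        using that by (auto simp: T_def indicator_def)
    qed
    also have "\<dots> = (\<integral>\<omega>. \<bar>X i \<omega>\<bar> * indicator T \<omega> \<partial>M) + \<bar>c\<bar> * prob A"
      using intT by (subst Bochner_Integration.integral_add) (auto simp: emeasure_eq_measure)
    also have "(\<integral>\<omega>. \<bar>X i \<omega>\<bar> * indicator T \<omega> \<partial>M) \<le> e"
      using c[OF \<open>i \<in> I\<close>] by (simp add: set_lebesgue_integral_def T_def mult.commute)
    finally show ?thesis by simp
  qed
  then show thesis by (intro that[of "\<bar>c\<bar>"]) auto
qed

theorem theorem6p1:
  fixes scale :: "complex \<Rightarrow> 'a::ring_1 \<Rightarrow> 'a" and star :: "'a \<Rightarrow> 'a" and \<phi> :: "'a \<Rightarrow> complex"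
    and scale' :: "complex \<Rightarrow> 'b::ring_1 \<Rightarrow> 'b" and star' :: "'b \<Rightarrow> 'b" and \<phi>' :: "'b \<Rightarrow> complex"
    and a :: "nat \<Rightarrow> 'a" and l :: 'b and \<alpha> :: real and K :: "nat \<Rightarrow> real"
    and w :: "nat \<Rightarrow> nat" and P :: "'o measure" and N :: "nat \<Rightarrow> 'o \<Rightarrow> nat"
  assumes A_ncp: "noncommutative_probability_space scale star \<phi>"
    and A_tracial: "tracial \<phi>"
    and A_positive: "positive_functional star \<phi>"
    and a_zero: "a 0 = 0"
    and a_self_adjoint: "\<And>n. n \<ge> 1 \<Longrightarrow> self_adjoint star (a n)"
    and K_pos: "\<And>n. K n > 0"
    and B_ncp: "noncommutative_probability_space scale' star' \<phi>'"
    and l_self_adjoint: "self_adjoint star' l"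
    and C1: "moments_converge (\<lambda>_. \<phi>)
               (\<lambda>n. scale (complex_of_real (1 / K n)) (a n - scale (complex_of_real \<alpha>) 1)) \<phi>' l"
    and C2: "\<exists>\<delta>>0. \<forall>\<epsilon> \<epsilon>'. 0 < \<epsilon> \<and> \<epsilon> < \<delta> \<and> 0 < \<epsilon>' \<and> \<epsilon>' < \<delta> \<longrightarrow>
               (\<exists>M::nat. \<forall>n>M. \<forall>m\<ge>1. \<forall>n'. \<bar>real n' - real n\<bar> < real n * \<epsilon>' \<longrightarrow>
                 cmod (\<phi> (scale (complex_of_real (1 / K n)) (a n' - a n) ^ m)) < \<epsilon>)"
    and w_pos: "\<And>n. n \<ge> 1 \<Longrightarrow> w n \<ge> 1"
    and w_mono: "mono_on {1..} w"
    and w_lim: "filterlim w at_top sequentially"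
    and P_prob: "prob_space P"
    and N_rv: "\<And>n. n \<ge> 1 \<Longrightarrow> N n \<in> measurable P (count_space UNIV)"
    and N_moments: "\<And>n k::nat. n \<ge> 1 \<Longrightarrow> integrable P (\<lambda>\<omega>. real (N n \<omega>) ^ k)"
    and N_lim: "converges_in_probability P (\<lambda>n \<omega>. real (N n \<omega>) / real (w n)) 1"
    and K_ui: "\<And>m::nat. m \<ge> 1 \<Longrightarrow>
               uniformly_integrable P {1::nat..} (\<lambda>n \<omega>. (K (N n \<omega>) / K (w n)) ^ m)"
  shows "moments_converge (\<lambda>_. expectation_functional P \<phi>)
           (\<lambda>n \<omega>. scale (complex_of_real (1 / K (w n))) (a (N n \<omega>) - scale (complex_of_real \<alpha>) 1))
           \<phi>' l"
proof -

  \<comment> \<open>Normalised variables and bounds on their moments\<close>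
  interpret noncommutative_probability_space scale star \<phi> by (rule A_ncp)
  interpret P: prob_space P by (rule P_prob)
  define b where "b i = scale (complex_of_real (1 / K i)) (a i - scale (complex_of_real \<alpha>) 1)" for i
  define Z where "Z n \<omega> = K (N n \<omega>) / K (w n)" for n \<omega>
  define X where "X n \<omega> = scale (complex_of_real (1 / K (w n))) (a (N n \<omega>) - scale (complex_of_real \<alpha>) 1)"
    for n \<omega>
  have Z_pos: "Z n \<omega> > 0" for n \<omega>
    using K_pos by (simp add: Z_def)
  \<comment> \<open>Changing the normalisation from \<open>K (w n)\<close> to
    \<open>K (N n \<omega>)\<close> splits off the scalar \<open>Z n \<omega>\<close>, so moments of
    \<open>X\<close> are powers of \<open>Z\<close> times moments of \<open>b\<close> at the random
    index.\<close>
  have X_eq: "X n \<omega> = scale (complex_of_real (Z n \<omega>)) (b (N n \<omega>))" for n \<omega>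
    using K_pos[of "N n \<omega>"] by (simp add: X_def b_def Z_def)
  \<comment> \<open>Both variables are normalised by \<open>K (w n)\<close>, so \<alpha> cancels and
    the difference is exactly the variable of \<open>C2\<close> at the indices \<open>w n\<close>
    and \<open>N n \<omega>\<close>.\<close>
  have X_minus_b: "X n \<omega> - b (w n) = scale (complex_of_real (1 / K (w n))) (a (N n \<omega>) - a (w n))" for n \<omega>
    by (simp add: X_def b_def scale_right_diff_distrib)
  \<comment> \<open>The random index may be 0, which the hypothesis of self-adjointness does not
    cover; there \<open>a_zero\<close> helps.\<close>
  have "self_adjoint star (a i)" for i
    using a_self_adjoint[of i] by (cases "i = 0") (auto simp: a_zero self_adjoint_def star_zero)
  moreover have "self_adjoint star (scale (complex_of_real \<alpha>) 1)"
    by (rule self_adjoint_scale_of_real) (simp add: self_adjoint_def star_one)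
  ultimately have b_sa: "self_adjoint star (b i)" for i
    unfolding b_def by (intro self_adjoint_scale_of_real[OF self_adjoint_diff])
  have X_sa: "self_adjoint star (X n \<omega>)" for n \<omega>
    unfolding X_eq by (intro self_adjoint_scale_of_real b_sa)
  have b_lim: "(\<lambda>i. \<phi> (b i ^ k)) \<longlonglongrightarrow> \<phi>' (l ^ k)" for k
    using C1 by (simp add: moments_converge_def b_def)
  \<comment> \<open>The bounds \<open>C k\<close> obtained from convergence hold for every index,
    hence also for a random one.\<close>
  have "Bseq (\<lambda>i. \<phi> (b i ^ k))" for k
    using b_lim by (rule convergent_imp_Bseq[OF convergentI])
  then have "\<exists>C. \<forall>i. cmod (\<phi> (b i ^ k)) \<le> C" for k
    by (auto simp: Bseq_def)
  then obtain C where b_le: "\<And>k i. cmod (\<phi> (b i ^ k)) \<le> C k"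
    by metis
  have C_nonneg: "C k \<ge> 0" for k
    using norm_ge_zero b_le[of 0 k] by (rule order_trans)
  have X_le: "cmod (\<phi> (X n \<omega> ^ k)) \<le> C k * Z n \<omega> ^ k" for n \<omega> k
  proof -
    have "cmod (\<phi> (X n \<omega> ^ k)) = Z n \<omega> ^ k * cmod (\<phi> (b (N n \<omega>) ^ k))"
      using Z_pos[of n \<omega>] by (simp add: X_eq scale_power functional_scale norm_mult norm_power)
    also have "\<dots> \<le> Z n \<omega> ^ k * C k"
      using Z_pos[of n \<omega>] by (intro mult_left_mono b_le) auto
    finally show ?thesis by (simp add: mult.commute)
  qed

  \<comment> \<open>Moments of the random ratio \<open>Z\<close>\<close>
  have Z_ui: "uniformly_integrable P {1::nat..} (\<lambda>n \<omega>. Z n \<omega> ^ k)" if "k \<ge> 1" for k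
    using K_ui[OF that] by (simp add: Z_def)
  have Z_int: "integrable P (\<lambda>\<omega>. Z n \<omega> ^ k)" if "n \<ge> 1" for n k
    using Z_ui[of k] that by (cases "k \<ge> 1") (auto simp: uniformly_integrable_def not_le)
  \<comment> \<open>Every function of a discrete variable is measurable, so the algebra needs no
    sigma-algebra.\<close>
  have N_meas: "(\<lambda>\<omega>. f (N n \<omega>)) \<in> borel_measurable P" if "n \<ge> 1" for n and f :: "nat \<Rightarrow> complex"
    using N_rv[OF that] by (rule measurable_compose) simp
  have X_int: "integrable P (\<lambda>\<omega>. \<phi> (X n \<omega> ^ k))" if "n \<ge> 1" for n k
  proof (rule Bochner_Integration.integrable_bound)
    show "integrable P (\<lambda>\<omega>. C k * Z n \<omega> ^ k)"
      using Z_int[OF that] by simp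
    show "(\<lambda>\<omega>. \<phi> (X n \<omega> ^ k)) \<in> borel_measurable P"
      unfolding X_def by (rule N_meas[OF that])
    show "AE \<omega> in P. cmod (\<phi> (X n \<omega> ^ k)) \<le> norm (C k * Z n \<omega> ^ k)"
      using X_le C_nonneg Z_pos by (intro AE_I2) (simp add: abs_mult less_imp_le)
  qed
  have Z_on_sets: "\<exists>c\<ge>0. \<forall>n\<ge>1. \<forall>A\<in>sets P. (\<integral>\<omega>. Z n \<omega> ^ k * indicator A \<omega> \<partial>P) \<le> e + c * P.prob A"
    if e: "e > 0" for e k
  proof (cases "k \<ge> 1")
    case True
    obtain c where c: "c \<ge> 0" "\<And>n A. n \<in> {1..} \<Longrightarrow> A \<in> sets P \<Longrightarrow>
        (\<integral>\<omega>. \<bar>Z n \<omega> ^ k\<bar> * indicator A \<omega> \<partial>P) \<le> e + c * P.prob A"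
      by (rule P.uniformly_integrable_on_sets[OF Z_ui[OF True] e]) blast
    have "\<bar>Z n \<omega> ^ k\<bar> = Z n \<omega> ^ k" for n \<omega>
      using Z_pos[of n \<omega>] by simp
    with c show ?thesis by auto
  next
    case False
    \<comment> \<open>For k = 0 the integrand is the indicator of \<open>A\<close>, so the constant
      1 works.\<close>
    with e show ?thesis by (intro exI[of _ 1]) (auto simp: not_le)
  qed
  \<comment> \<open>Taking the whole space as the event bounds the means of Z^k uniformly in
    n.\<close>
  have "\<exists>B. \<forall>n\<ge>1. (\<integral>\<omega>. Z n \<omega> ^ k \<partial>P) \<le> B" for k
  proof -
    obtain c where c: "\<forall>n\<ge>1. \<forall>A\<in>sets P. (\<integral>\<omega>. Z n \<omega> ^ k * indicator A \<omega> \<partial>P) \<le> 1 + c * P.prob A"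
      using Z_on_sets[of 1 k] by auto
    have "(\<integral>\<omega>. Z n \<omega> ^ k \<partial>P) \<le> 1 + c" if "n \<ge> 1" for n
    proof -
      have "(\<integral>\<omega>. Z n \<omega> ^ k \<partial>P) = (\<integral>\<omega>. Z n \<omega> ^ k * indicator (space P) \<omega> \<partial>P)"
        by (rule Bochner_Integration.integral_cong) auto
      also have "\<dots> \<le> 1 + c * P.prob (space P)"
        using c that by blast
      finally show ?thesis by (simp add: P.prob_space)
    qed
    then show ?thesis by blast
  qed
  then obtain B where Z_le: "\<And>k n. n \<ge> 1 \<Longrightarrow> (\<integral>\<omega>. Z n \<omega> ^ k \<partial>P) \<le> B k"
    by metis

  \<comment> \<open>The event that \<open>N n\<close> is far from \<open>w n\<close>\<close>
  obtain \<delta> where "\<delta> > 0" and C2': "\<And>\<epsilon>. 0 < \<epsilon> \<Longrightarrow> \<epsilon> < \<delta> \<Longrightarrow>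
      \<exists>M::nat. \<forall>n>M. \<forall>m\<ge>1. \<forall>n'. \<bar>real n' - real n\<bar> < real n * (\<delta> / 2) \<longrightarrow>
        cmod (\<phi> (scale (complex_of_real (1 / K n)) (a n' - a n) ^ m)) < \<epsilon>"
  proof -
    from C2 obtain \<delta> where "\<delta> > 0" and *: "\<forall>\<epsilon> \<epsilon>'. 0 < \<epsilon> \<and> \<epsilon> < \<delta> \<and> 0 < \<epsilon>' \<and> \<epsilon>' < \<delta> \<longrightarrow>
        (\<exists>M::nat. \<forall>n>M. \<forall>m\<ge>1. \<forall>n'. \<bar>real n' - real n\<bar> < real n * \<epsilon>' \<longrightarrow>
          cmod (\<phi> (scale (complex_of_real (1 / K n)) (a n' - a n) ^ m)) < \<epsilon>)"
      by blast
    \<comment> \<open>One fixed relative window \<delta>/2 is enough, since \<open>N n / w n\<close>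
      eventually lies in any window with high probability; only \<epsilon> still varies.\<close>
    show thesis
      using *[rule_format, of _ "\<delta> / 2"] \<open>\<delta> > 0\<close> by (intro that[of \<delta>]) auto
  qed
  \<comment> \<open>The threshold \<delta>/4 lies below \<delta>/2, so that off \<open>A n\<close>
    the strict inequality required by \<open>C2'\<close> holds.\<close>
  define A where "A n = {\<omega> \<in> space P. \<bar>real (N n \<omega>) / real (w n) - 1\<bar> > \<delta> / 4}" for n
  have A_sets: "A n \<in> sets P" if "n \<ge> 1" for n
  proof -
    note [measurable] = N_rv[OF that]
    show ?thesis unfolding A_def by measurable
  qed
  have A_lim: "(\<lambda>n. P.prob (A n)) \<longlonglongrightarrow> 0"
    unfolding A_def using \<open>\<delta> > 0\<close>
    by (intro N_lim[unfolded converges_in_probability_def, rule_format]) simp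
  have Z_A_lim: "(\<lambda>n. \<integral>\<omega>. Z n \<omega> ^ k * indicator (A n) \<omega> \<partial>P) \<longlonglongrightarrow> 0" for k
  proof (rule tendstoI)
    fix e :: real assume "e > 0"
    then obtain c where c: "c \<ge> 0" "\<forall>n\<ge>1. \<forall>A\<in>sets P.
        (\<integral>\<omega>. Z n \<omega> ^ k * indicator A \<omega> \<partial>P) \<le> e / 2 + c * P.prob A"
      using Z_on_sets[of "e / 2" k] by auto
    have "(\<lambda>n. e / 2 + c * P.prob (A n)) \<longlonglongrightarrow> e / 2 + c * 0"
      by (intro tendsto_intros A_lim)
    then have "\<forall>\<^sub>F n in sequentially. e / 2 + c * P.prob (A n) < e"
      by (rule order_tendstoD(2)) (use \<open>e > 0\<close> in simp)
    then show "\<forall>\<^sub>F n in sequentially. dist (\<integral>\<omega>. Z n \<omega> ^ k * indicator (A n) \<omega> \<partial>P) 0 < e"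
      using eventually_ge_at_top[of 1]
    proof eventually_elim
      case (elim n)
      have "(\<integral>\<omega>. Z n \<omega> ^ k * indicator (A n) \<omega> \<partial>P) \<ge> 0"
        using Z_pos by (intro Bochner_Integration.integral_nonneg) (simp add: less_imp_le)
      moreover have "(\<integral>\<omega>. Z n \<omega> ^ k * indicator (A n) \<omega> \<partial>P) < e"
        using c(2) A_sets[OF elim(2)] elim by fastforce
      ultimately show ?case by simp
    qed
  qed

  \<comment> \<open>Comparison of the moments at the random and the deterministic index\<close>
  have diff_lim: "(\<lambda>n. (\<integral>\<omega>. \<phi> (X n \<omega> ^ m) \<partial>P) - \<phi> (b (w n) ^ m)) \<longlonglongrightarrow> 0" for m
  proof (rule tendstoI)
    fix e :: real assume "e > 0"
    define S where "S = (\<Sum>k<m. 1 + C (4 * k) * B (4 * k) + C (4 * (m - 1 - k)))"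
    obtain \<eta> where "\<eta> > 0" and \<eta>: "\<eta>\<^sup>2 < \<delta>" "\<eta> * S < e"
    proof -
      have "((\<lambda>\<eta>::real. \<eta>\<^sup>2) \<longlongrightarrow> 0\<^sup>2) (at_right 0)" "((\<lambda>\<eta>. \<eta> * S) \<longlongrightarrow> 0 * S) (at_right 0)"
        by (intro tendsto_intros)+
      from order_tendstoD(2)[OF this(1), of \<delta>] order_tendstoD(2)[OF this(2), of e]
      have "\<forall>\<^sub>F \<eta>::real in at_right 0. \<eta>\<^sup>2 < \<delta> \<and> \<eta> * S < e \<and> \<eta> > 0"
        using \<open>\<delta> > 0\<close> \<open>e > 0\<close> by (simp add: eventually_conj eventually_at_right_less)
      then show thesis
        using that eventually_happens'[OF trivial_limit_at_right_real] by blast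
    qed
    \<comment> \<open>Only the second moment, m = 2, of the increments is called for.\<close>
    obtain M :: nat where M: "\<And>n n'. n > M \<Longrightarrow> \<bar>real n' - real n\<bar> < real n * (\<delta> / 2) \<Longrightarrow>
        cmod (\<phi> (scale (complex_of_real (1 / K n)) (a n' - a n) ^ 2)) < \<eta>\<^sup>2"
      using C2'[of "\<eta>\<^sup>2"] \<eta> \<open>\<eta> > 0\<close> by (metis one_le_numeral zero_less_power)
    have "(\<lambda>n. \<eta> * S + C m * ((\<integral>\<omega>. Z n \<omega> ^ m * indicator (A n) \<omega> \<partial>P) + P.prob (A n)))
        \<longlonglongrightarrow> \<eta> * S + C m * (0 + 0)"
      by (intro tendsto_intros Z_A_lim A_lim)
    then have "\<forall>\<^sub>F n in sequentially.
        \<eta> * S + C m * ((\<integral>\<omega>. Z n \<omega> ^ m * indicator (A n) \<omega> \<partial>P) + P.prob (A n)) < e"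
      by (rule order_tendstoD(2)) (use \<eta> in simp)
    moreover have "\<forall>\<^sub>F n in sequentially. w n > M"
      by (rule eventually_compose_filterlim[OF eventually_gt_at_top w_lim])
    ultimately show "\<forall>\<^sub>F n in sequentially.
        dist ((\<integral>\<omega>. \<phi> (X n \<omega> ^ m) \<partial>P) - \<phi> (b (w n) ^ m)) 0 < e"
      using eventually_ge_at_top[of 1]
    proof eventually_elim
      case (elim n)
      \<comment> \<open>\<open>G\<close> dominates the difference off \<open>A n\<close> through
        \<open>functional_power_diff_le\<close>, and \<open>H\<close> dominates it on
        \<open>A n\<close> by the triangle inequality. Both are nonnegative, so their sum dominates
        everywhere; the mean of \<open>G\<close> is at most \<eta> S, and that of \<open>H\<close>
        tends to 0.\<close>
      define G where "G \<omega> = \<eta> * (\<Sum>k<m. 1 + C (4 * k) * Z n \<omega> ^ (4 * k) + C (4 * (m - 1 - k)))" for \<omega>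
      define H where "H \<omega> = C m * (Z n \<omega> ^ m * indicator (A n) \<omega> + indicator (A n) \<omega>)" for \<omega>
      note [measurable] = A_sets[OF elim(3)]
      have G_nonneg: "G \<omega> \<ge> 0" for \<omega>
        unfolding G_def using \<open>\<eta> > 0\<close> C_nonneg Z_pos[of n \<omega>] by (intro mult_nonneg_nonneg sum_nonneg) auto
      have H_nonneg: "H \<omega> \<ge> 0" for \<omega>
        unfolding H_def using C_nonneg Z_pos[of n \<omega>] by auto
      have bound: "cmod (\<phi> (X n \<omega> ^ m) - \<phi> (b (w n) ^ m)) \<le> G \<omega> + H \<omega>" if "\<omega> \<in> space P" for \<omega>
      proof (cases "\<omega> \<in> A n")
        case True
        have "cmod (\<phi> (X n \<omega> ^ m) - \<phi> (b (w n) ^ m)) \<le> C m * Z n \<omega> ^ m + C m"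
          using norm_triangle_ineq4 X_le[of n \<omega> m] b_le[of "w n" m] by (smt (verit))
        also have "\<dots> = H \<omega>"
          using True by (simp add: H_def algebra_simps)
        finally show ?thesis using G_nonneg[of \<omega>] by simp
      next
        case False
        have "real (w n) > 0"
          using w_pos[OF elim(3)] by simp
        have "\<bar>real (N n \<omega>) / real (w n) - 1\<bar> < \<delta> / 2"
          using False that \<open>\<delta> > 0\<close> by (auto simp: A_def)
        moreover have "real (N n \<omega>) - real (w n) = real (w n) * (real (N n \<omega>) / real (w n) - 1)"
          using \<open>real (w n) > 0\<close> by (simp add: field_simps)
        ultimately have "\<bar>real (N n \<omega>) - real (w n)\<bar> < real (w n) * (\<delta> / 2)"
          using \<open>real (w n) > 0\<close> by (simp add: abs_mult)
        from M[OF elim(2) this] have "cmod (\<phi> ((X n \<omega> - b (w n)) ^ 2)) \<le> \<eta>\<^sup>2"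
          by (simp add: X_minus_b)
        from functional_power_diff_le[OF A_positive A_tracial X_sa b_sa \<open>\<eta> > 0\<close> this]
        have "cmod (\<phi> (X n \<omega> ^ m) - \<phi> (b (w n) ^ m)) \<le> \<eta> * (\<Sum>k<m. 1 + cmod (\<phi> (X n \<omega> ^ (4 * k)))
            + cmod (\<phi> (b (w n) ^ (4 * (m - 1 - k)))))" .
        also have "\<dots> \<le> G \<omega>"
          unfolding G_def using \<open>\<eta> > 0\<close> by (intro mult_left_mono sum_mono add_mono X_le b_le) auto
        finally show ?thesis using H_nonneg[of \<omega>] by simp
      qed
      have G_int: "integrable P G"
        unfolding G_def using Z_int[OF elim(3)] by auto
      have Z_A_int: "integrable P (\<lambda>\<omega>. Z n \<omega> ^ m * indicator (A n) \<omega>)"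
        by (rule integrable_real_mult_indicator) (use Z_int[OF elim(3)] in auto)
      have A_int: "integrable P (indicator (A n) :: _ \<Rightarrow> real)"
        by (simp add: P.emeasure_eq_measure)
      have H_int: "integrable P H"
        unfolding H_def using Z_A_int A_int by (intro integrable_mult_right Bochner_Integration.integrable_add)
      have "(\<integral>\<omega>. G \<omega> \<partial>P) = \<eta> * (\<Sum>k<m. 1 + C (4 * k) * (\<integral>\<omega>. Z n \<omega> ^ (4 * k) \<partial>P) + C (4 * (m - 1 - k)))"
        unfolding G_def using Z_int[OF elim(3)]
        by (simp add: Bochner_Integration.integral_sum Bochner_Integration.integral_add P.prob_space)
      also have "\<dots> \<le> \<eta> * S"
        unfolding S_def using \<open>\<eta> > 0\<close> Z_le[OF elim(3)] C_nonneg
        by (intro mult_left_mono sum_mono add_mono) auto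
      finally have G_le: "(\<integral>\<omega>. G \<omega> \<partial>P) \<le> \<eta> * S" .
      have H_eq: "(\<integral>\<omega>. H \<omega> \<partial>P) = C m * ((\<integral>\<omega>. Z n \<omega> ^ m * indicator (A n) \<omega> \<partial>P) + P.prob (A n))"
        unfolding H_def using Z_A_int A_int by (simp add: Bochner_Integration.integral_add)
      have "(\<integral>\<omega>. \<phi> (X n \<omega> ^ m) \<partial>P) - \<phi> (b (w n) ^ m) = (\<integral>\<omega>. \<phi> (X n \<omega> ^ m) - \<phi> (b (w n) ^ m) \<partial>P)"
        using X_int[OF elim(3)] by (simp add: P.prob_space)
      also have "cmod \<dots> \<le> (\<integral>\<omega>. G \<omega> + H \<omega> \<partial>P)"
        by (rule order_trans[OF integral_norm_bound integral_mono])
          (use bound X_int[OF elim(3)] G_int H_int in auto)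
      also have "\<dots> = (\<integral>\<omega>. G \<omega> \<partial>P) + (\<integral>\<omega>. H \<omega> \<partial>P)"
        using G_int H_int by (rule Bochner_Integration.integral_add)
      finally show ?case
        using G_le H_eq elim(1) by simp
    qed
  qed
  \<comment> \<open>Since \<open>w n\<close> tends to infinity, the moments of
    \<open>b (w n)\<close> inherit the limit in \<open>C1\<close>.\<close>
  have "(\<lambda>n. \<integral>\<omega>. \<phi> (X n \<omega> ^ m) \<partial>P) \<longlonglongrightarrow> \<phi>' (l ^ m)" for m
    using tendsto_add[OF diff_lim[of m] filterlim_compose[OF b_lim[of m] w_lim]] by simp
  then show ?thesis
    by (simp add: moments_converge_def expectation_functional_def fun_power_apply X_def)
qed

end
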